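(* Let $\mathbb{K}$ be an algebraically closed field of characteristic zero, let $n \geq 1$, and let $\mathfrak{sp}_{2n}(\mathbb{K})$ be the symplectic Lie algebra. For any nonzero nilpotent element $X \in \mathfrak{sp}_{2n}(\mathbb{K})$ there exists a nilpotent element $Y \in \mathfrak{sp}_{2n}(\mathbb{K})$ such that $X$ and $Y$ generate $\mathfrak{sp}_{2n}(\mathbb{K})$ as a Lie algebra.
   Context: For a $2n$-dimensional vector space $V$ over $\mathbb{K}$ with a non-degenerate skew-symmetric bilinear form $\Omega$, the symplectic Lie algebra $\mathfrak{sp}_{2n}(\mathbb{K})$ is the Lie algebra of all linear transformations $A$ of $V$ that annihilate $\Omega$, i.e. $\Omega(Au,v)+\Omega(u,Av)=0$ for all $u,v\in V$, with the commutator bracket. An element is nilpotent if it is nilpotent as a linear transformation of $V$. Two elements generate the Lie algebra if the smallest Lie subalgebra containing both is the whole algebra. *)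

theory Defs
  imports
    "HOL-Computational_Algebra.Polynomial"
    "HOL-Library.Function_Algebras"
begin

text \<open>
  The space \<open>V\<close> is the whole type \<open>'v\<close>, and endomorphisms of \<open>V\<close> are functions
  \<open>'v \<Rightarrow> 'v\<close> with the pointwise vector space structure.
\<close>

definition (in vector_space) scale_endo :: "'a \<Rightarrow> ('b \<Rightarrow> 'b) \<Rightarrow> 'b \<Rightarrow> 'b" where
  "scale_endo c A = (\<lambda>v. scale c (A v))"

lemma (in vector_space) vector_space_scale_endo: "vector_space scale_endo"
  by unfold_locales (auto simp: scale_endo_def fun_eq_iff algebra_simps)

definition commutator :: "('v \<Rightarrow> 'v) \<Rightarrow> ('v \<Rightarrow> 'v) \<Rightarrow> 'v \<Rightarrow> 'v::ab_group_add" where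
  "commutator A B = (A \<circ> B) - (B \<circ> A)"

definition nilpotent_endo :: "('v \<Rightarrow> 'v::zero) \<Rightarrow> bool" where
  "nilpotent_endo A \<longleftrightarrow> (\<exists>k. A ^^ k = 0)"

text \<open>
  A set of endomorphisms that is a Lie algebra under the commutator.
  (Elements are not required to be linear here: below this is only applied to subsets
  of the symplectic Lie algebra.)
\<close>

definition (in vector_space) lie_closed :: "('b \<Rightarrow> 'b) set \<Rightarrow> bool" where
  "lie_closed L \<longleftrightarrow>
     module.subspace scale_endo L \<and> (\<forall>A\<in>L. \<forall>B\<in>L. commutator A B \<in> L)"

definition (in vector_space) lie_subalgebra :: "('b \<Rightarrow> 'b) set \<Rightarrow> ('b \<Rightarrow> 'b) set \<Rightarrow> bool" where
  "lie_subalgebra L G \<longleftrightarrow> L \<subseteq> G \<and> lie_closed L"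

definition (in vector_space) lie_generates :: "('b \<Rightarrow> 'b) set \<Rightarrow> ('b \<Rightarrow> 'b) set \<Rightarrow> bool" where
  "lie_generates S G \<longleftrightarrow> (\<lambda>L. lie_subalgebra L G) hull S = G"

lemma (in vector_space) finite_basis_if_dim_pos:
  assumes "dim (UNIV :: 'b set) > 0"
  shows "\<exists>B :: 'b set. finite B \<and> independent B \<and> span B = UNIV"
  using assms basis_exists[of "UNIV :: 'b set"] by (metis card_ge_0_finite top.extremum_unique)

text \<open>
  Finite dimensionality is not part of this locale.  As \<open>dim\<close> is \<open>0\<close> on infinite-dimensional
  spaces, it follows from \<open>dim UNIV = 2 * n\<close> with \<open>n \<ge> 1\<close> by the previous lemma.
\<close>

locale symplectic_space = vector_space scale
  for scale :: "'k::field \<Rightarrow> 'v::ab_group_add \<Rightarrow> 'v" +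
  fixes \<Omega> :: "'v \<Rightarrow> 'v \<Rightarrow> 'k"
  assumes linear_left: "\<And>v. Vector_Spaces.linear scale (*) (\<lambda>u. \<Omega> u v)"
    and linear_right: "\<And>u. Vector_Spaces.linear scale (*) (\<lambda>v. \<Omega> u v)"
    and skew_symmetric: "\<And>u v. \<Omega> u v = - \<Omega> v u"
    and nondegenerate: "\<And>u. (\<And>v. \<Omega> u v = 0) \<Longrightarrow> u = 0"
begin

definition sp :: "('v \<Rightarrow> 'v) set" where
  "sp = {A. Vector_Spaces.linear scale scale A \<and> (\<forall>u v. \<Omega> (A u) v + \<Omega> u (A v) = 0)}"

lemma lie_subalgebra_sp: "lie_subalgebra sp sp"
proof -
  interpret E: vector_space scale_endo by (rule vector_space_scale_endo)
  interpret P: vector_space_pair scale scale ..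
  have add1: "\<Omega> (x + y) v = \<Omega> x v + \<Omega> y v" and add2: "\<Omega> v (x + y) = \<Omega> v x + \<Omega> v y" for x y v
    using linear_left linear_right by (auto simp: Vector_Spaces.linear_def module_hom_iff)
  have zero1: "\<Omega> 0 v = 0" and zero2: "\<Omega> v 0 = 0" for v
    using add1[of 0 0 v] add2[of v 0 0] by (simp_all only: add_0_left add_cancel_right_left)
  have diff1: "\<Omega> (x - y) v = \<Omega> x v - \<Omega> y v" and diff2: "\<Omega> v (x - y) = \<Omega> v x - \<Omega> v y" for x y v
    using add1[of "x - y" y v] add2[of v "x - y" y] by simp_all
  have scale1: "\<Omega> (scale c x) v = c * \<Omega> x v" and scale2: "\<Omega> v (scale c x) = c * \<Omega> v x" for c x v
    using linear_left linear_right by (auto simp: Vector_Spaces.linear_def module_hom_iff)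
  have "E.subspace sp"
    unfolding E.subspace_def
  proof (intro conjI ballI allI)
    show "0 \<in> sp"
      by (auto simp: sp_def zero_fun_def P.module_hom_zero zero1 zero2 intro: P.linear_zero)
  next
    fix A B assume "A \<in> sp" "B \<in> sp"
    moreover have "\<Omega> (A u) v + \<Omega> (B u) v + (\<Omega> u (A v) + \<Omega> u (B v))
        = (\<Omega> (A u) v + \<Omega> u (A v)) + (\<Omega> (B u) v + \<Omega> u (B v))" for u v
      by (simp add: algebra_simps)
    ultimately show "A + B \<in> sp"
      by (simp add: sp_def plus_fun_def P.linear_compose_add add1 add2)
  next
    fix c A assume "A \<in> sp"
    moreover have "c * \<Omega> (A u) v + c * \<Omega> u (A v) = c * (\<Omega> (A u) v + \<Omega> u (A v))" for u v
      by (simp add: algebra_simps)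
    ultimately show "scale_endo c A \<in> sp"
      by (simp add: sp_def scale_endo_def P.linear_compose_scale_right scale1 scale2)
  qed
  moreover have "commutator A B \<in> sp" if "A \<in> sp" "B \<in> sp" for A B
  proof -
    have lin: "Vector_Spaces.linear scale scale (\<lambda>v. A (B v) - B (A v))"
      using that by (auto simp: sp_def Vector_Spaces.linear_def module_hom_iff algebra_simps)
    have sw: "\<Omega> (A u) v = - \<Omega> u (A v)" "\<Omega> (B u) v = - \<Omega> u (B v)" for u v
      using that by (auto simp: sp_def eq_neg_iff_add_eq_0)
    show ?thesis
      using lin by (simp add: sp_def commutator_def fun_diff_def o_def diff1 diff2 sw)
  qed
  ultimately show ?thesis by (auto simp: lie_subalgebra_def lie_closed_def)
qed

end

end

theory Submission
  imports Defs
begin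

text \<open>
  The partner of \<open>X\<close> is a regular nilpotent \<open>Y\<close> adapted to \<open>X\<close>.  As \<open>X \<noteq> 0\<close>, the quadratic form
  \<open>v \<mapsto> \<Omega> (X v) v\<close> does not vanish identically; choose \<open>e\<close> with \<open>\<Omega> (X e) e \<noteq> 0\<close>.  Put
  \<open>M = 2 * n - 1\<close> and choose a basis \<open>w 0, \<dots>, w M\<close> of \<open>V\<close> ending in \<open>w M = e\<close>, for which
  \<open>\<Omega> (w i) (w j)\<close> is \<open>(-1) ^ i\<close> if \<open>i + j = M\<close> and \<open>0\<close> otherwise
  (lemma \<open>darboux_chain_exists\<close>).  The map \<open>Y\<close> that shifts this basis, \<open>w i \<mapsto> w (i + 1)\<close>, is nilpotent,
  and it lies in \<open>sp\<close> because of the alternating signs.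

  The Lie algebra \<open>sp\<close> is the symmetric square of \<open>V\<close>: the product \<open>u v\<close> acts by
  \<open>x \<mapsto> \<Omega> u x \<cdot> v + \<Omega> v x \<cdot> u\<close>, and \<open>[A, u v] = (A u) v + u (A v)\<close> for \<open>A\<close> in \<open>sp\<close>.  Give
  \<open>(w i) (w j)\<close> the weight \<open>i + j\<close>, and let \<open>F d\<close> be the span of the products of weight at least
  \<open>d\<close>.  Then \<open>F 0 = sp\<close> and \<open>F (2 * M + 1) = 0\<close>; the operator \<open>ad Y\<close> raises the weight by one, and the
  bracket lowers the total weight by \<open>M\<close>.  By the choice of \<open>e\<close>, the component of \<open>X\<close> of weight
  \<open>0\<close> is a nonzero multiple of \<open>(w 0) (w 0)\<close>.

  Let \<open>L\<close> be a Lie algebra containing \<open>X\<close> and \<open>Y\<close>.  It is enough that each \<open>(w i) (w m)\<close> is the leading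
  term (that is, the component of lowest weight) of an element of \<open>L\<close>, because then a descending
  induction on \<open>d\<close> gives \<open>F d \<subseteq> L\<close>.  Up to the scalar in \<open>X\<close>, the element \<open>(ad Y)^d X\<close> has the leading term
  \<open>\<Sum>i\<le>d. (d choose i) (w i) (w (d - i))\<close>.  For \<open>d = m + M\<close>, bracketing it with \<open>X\<close> leaves the
  leading term \<open>4 (d choose M) (w 0) (w m)\<close> up to a scalar: only \<open>w M\<close> pairs nontrivially with \<open>w 0\<close>.
  The coefficient is nonzero in characteristic zero, so all \<open>(w 0) (w m)\<close> are obtained.
  Finally \<open>ad Y\<close> maps \<open>(w i) (w m)\<close> to \<open>(w (i + 1)) (w m) + (w i) (w (m + 1))\<close>, which gives all other
  products by induction on \<open>i\<close> (lemma \<open>sp_subset_lie_closed\<close>).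
\<close>

section \<open>The symmetric square inside the symplectic Lie algebra\<close>

context symplectic_space
begin

interpretation E: vector_space scale_endo by (rule vector_space_scale_endo)

lemma form_add: "\<Omega> (x + y) v = \<Omega> x v + \<Omega> y v" "\<Omega> v (x + y) = \<Omega> v x + \<Omega> v y"
  using linear_left linear_right by (auto simp: Vector_Spaces.linear_def module_hom_iff)

lemma form_scale: "\<Omega> (scale c x) v = c * \<Omega> x v" "\<Omega> v (scale c x) = c * \<Omega> v x"
  using linear_left linear_right by (auto simp: Vector_Spaces.linear_def module_hom_iff)

lemma form_zero: "\<Omega> 0 v = 0" "\<Omega> v 0 = 0"
  using form_scale(1)[of 0 0 v] form_scale(2)[of v 0 0] by simp_all

lemma form_diff: "\<Omega> (x - y) v = \<Omega> x v - \<Omega> y v" "\<Omega> v (x - y) = \<Omega> v x - \<Omega> v y"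
  using form_add(1)[of "x - y" y v] form_add(2)[of v "x - y" y] by simp_all

lemma form_sum: "\<Omega> (\<Sum>i\<in>I. f i) v = (\<Sum>i\<in>I. \<Omega> (f i) v)" "\<Omega> v (\<Sum>i\<in>I. f i) = (\<Sum>i\<in>I. \<Omega> v (f i))"
  by (induction I rule: infinite_finite_induct) (simp_all add: form_add form_zero)

lemma form_minus: "\<Omega> (- x) v = - \<Omega> x v" "\<Omega> v (- x) = - \<Omega> v x"
  using form_diff[of 0 x v] form_diff(2)[of v 0 x] by (simp_all add: form_zero)

lemmas form_simps = form_add form_scale form_zero form_diff form_minus form_sum

text \<open>
  The product of \<open>u\<close> and \<open>v\<close> in the symmetric square of \<open>V\<close>, regarded as an endomorphism by means of the form.
\<close>

definition sym_prod :: "'v \<Rightarrow> 'v \<Rightarrow> 'v \<Rightarrow> 'v" where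
  "sym_prod u v x = scale (\<Omega> u x) v + scale (\<Omega> v x) u"

lemma sym_prod_commute: "sym_prod u v = sym_prod v u"
  by (simp add: sym_prod_def fun_eq_iff add.commute)

lemma sym_prod_add: "sym_prod (u + u') v = sym_prod u v + sym_prod u' v"
  by (simp add: sym_prod_def fun_eq_iff form_simps algebra_simps)

lemma sym_prod_scale: "sym_prod (scale c u) v = scale_endo c (sym_prod u v)"
  by (simp add: sym_prod_def fun_eq_iff form_simps scale_endo_def algebra_simps)

lemma sym_prod_zero: "sym_prod 0 v = 0" "sym_prod v 0 = 0"
  by (simp_all add: sym_prod_def fun_eq_iff form_simps)

lemma sym_prod_add_right: "sym_prod v (u + u') = sym_prod v u + sym_prod v u'"
  by (metis sym_prod_add sym_prod_commute)

lemma sym_prod_scale_right: "sym_prod v (scale c u) = scale_endo c (sym_prod v u)"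
  by (metis sym_prod_scale sym_prod_commute)

lemma sym_prod_sum_right: "sym_prod v (\<Sum>i\<in>I. f i) = (\<Sum>i\<in>I. sym_prod v (f i))"
  by (induction I rule: infinite_finite_induct) (simp_all add: sym_prod_add_right sym_prod_zero)

lemma sp_iff:
  "A \<in> sp \<longleftrightarrow> (\<forall>x y. A (x + y) = A x + A y) \<and> (\<forall>c x. A (scale c x) = scale c (A x))
     \<and> (\<forall>u v. \<Omega> (A u) v = - \<Omega> u (A v))"
  by (auto simp: sp_def Vector_Spaces.linear_def module_hom_iff vector_space_axioms module_axioms
      eq_neg_iff_add_eq_0)

lemma sym_prod_in_sp: "sym_prod u v \<in> sp"
proof -
  have "\<Omega> u a * \<Omega> v b + \<Omega> v a * \<Omega> u b = - (\<Omega> u b * \<Omega> a v + \<Omega> v b * \<Omega> a u)" for a b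
    by (subst (3 4) skew_symmetric) (simp add: algebra_simps)
  then show ?thesis
    by (auto simp: sp_iff sym_prod_def form_simps algebra_simps)
qed

lemma subspace_sp: "E.subspace sp"
  using lie_subalgebra_sp by (simp add: lie_subalgebra_def lie_closed_def)

text \<open>
  The identification of the symmetric square with endomorphisms is equivariant: \<open>A\<close> acts as a derivation,
  since invariance of the form moves \<open>A\<close> from the argument onto the vectors \<open>u\<close> and \<open>v\<close>.
\<close>

lemma commutator_sym_prod:
  assumes "A \<in> sp"
  shows "commutator A (sym_prod u v) = sym_prod (A u) v + sym_prod u (A v)"
  using assms by (auto simp: sp_iff commutator_def sym_prod_def fun_eq_iff form_simps algebra_simps)

lemma commutator_swap: "commutator A B = - commutator B A"
  by (simp add: commutator_def)

lemma commutator_add_left: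
  assumes "C \<in> sp" shows "commutator (A + B) C = commutator A C + commutator B C"
  using assms by (auto simp: sp_iff commutator_def fun_eq_iff)

lemma commutator_add_right:
  assumes "C \<in> sp" shows "commutator C (A + B) = commutator C A + commutator C B"
  using assms by (auto simp: sp_iff commutator_def fun_eq_iff)

lemma commutator_scale_right:
  assumes "C \<in> sp" shows "commutator C (scale_endo c A) = scale_endo c (commutator C A)"
  using assms by (auto simp: sp_iff commutator_def fun_eq_iff scale_endo_def algebra_simps)

lemma commutator_scale_left:
  assumes "C \<in> sp" shows "commutator (scale_endo c A) C = scale_endo c (commutator A C)"
  using assms by (auto simp: sp_iff commutator_def fun_eq_iff scale_endo_def algebra_simps)

lemma commutator_zero_right:
  assumes "C \<in> sp" shows "commutator C 0 = 0"
  using commutator_scale_right[OF assms, of 0] by simp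

lemma commutator_sum_right:
  assumes "C \<in> sp" shows "commutator C (\<Sum>i\<in>I. f i) = (\<Sum>i\<in>I. commutator C (f i))"
  by (induction I rule: infinite_finite_induct)
    (simp_all only: sum.infinite sum.empty sum.insert commutator_add_right assms commutator_zero_right not_False_eq_True)

end

section \<open>Darboux bases\<close>

locale symplectic_space_char_0 = symplectic_space scale \<Omega>
  for scale :: "'k::field_char_0 \<Rightarrow> 'v::ab_group_add \<Rightarrow> 'v" and \<Omega>
begin

lemma form_self: "\<Omega> v v = 0"
  using skew_symmetric[of v v] by (simp add: eq_neg_iff_add_eq_0)

text \<open>
  For \<open>A\<close> in \<open>sp\<close> the bilinear form \<open>(u, v) \<mapsto> \<Omega> (A u) v\<close> is symmetric, so polarization recovers it, and hence
  \<open>A\<close>, from its diagonal.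
\<close>

lemma sp_quadratic_form_nonzero:
  assumes "A \<in> sp" "A \<noteq> 0"
  obtains e where "\<Omega> (A e) e \<noteq> 0"
proof -
  have "A u = 0" if zero: "\<And>e. \<Omega> (A e) e = 0" for u
  proof (rule nondegenerate)
    fix v
    have "\<Omega> (A v) u = \<Omega> (A u) v"
      using assms(1) skew_symmetric[of v "A u"] by (simp add: sp_iff)
    moreover have "\<Omega> (A (u + v)) (u + v) = \<Omega> (A u) u + \<Omega> (A v) v + (\<Omega> (A u) v + \<Omega> (A v) u)"
      using assms(1) by (simp add: sp_iff form_simps)
    ultimately show "\<Omega> (A u) v = 0"
      using zero by simp
  qed
  then show ?thesis
    using assms(2) that by (metis ext zero_fun_def)
qed

definition hyperbolic :: "nat \<Rightarrow> (nat \<Rightarrow> 'v) \<Rightarrow> (nat \<Rightarrow> 'v) \<Rightarrow> bool" where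
  "hyperbolic k a b \<longleftrightarrow> (\<forall>i<k. \<forall>j<k. \<Omega> (a i) (a j) = 0 \<and> \<Omega> (b i) (b j) = 0
     \<and> \<Omega> (a i) (b j) = (if i = j then 1 else 0))"

text \<open>
  A symplectic Gram-Schmidt step: a vector outside the span of the given pairs is projected
  to the orthogonal complement of that span, and so is a vector that pairs nontrivially with
  the result.
\<close>

lemma hyperbolic_extend:
  assumes ab: "hyperbolic k a b" and dim: "2 * k < dim (UNIV :: 'v set)"
  obtains p q where "hyperbolic (Suc k) (a(k := p)) (b(k := q))"
proof -
  (* the orthogonal projection along the span of the given pairs *)
  define P where "P v = v - (\<Sum>i<k. scale (\<Omega> v (b i)) (a i) - scale (\<Omega> v (a i)) (b i))" for v
  have skew: "\<Omega> (b i) (a j) = (if i = j then - 1 else 0)" if "i < k" "j < k" for i j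
    using ab that skew_symmetric[of "b i" "a j"] by (simp add: hyperbolic_def)
  have Pa: "\<Omega> (P v) (a j) = 0" and Pb: "\<Omega> (P v) (b j) = 0" if "j < k" for v j
  proof -
    have "\<Omega> (P v) (a j) = \<Omega> v (a j) - (\<Sum>i<k. if i = j then \<Omega> v (a j) else 0)"
      unfolding P_def form_simps
      by (intro arg_cong2[of _ _ _ _ "(-)"] sum.cong refl)
        (use that ab in \<open>auto simp: skew hyperbolic_def\<close>)
    then show "\<Omega> (P v) (a j) = 0" using that by simp
    have "\<Omega> (P v) (b j) = \<Omega> v (b j) - (\<Sum>i<k. if i = j then \<Omega> v (b j) else 0)"
      unfolding P_def form_simps
      by (intro arg_cong2[of _ _ _ _ "(-)"] sum.cong refl)
        (use that ab in \<open>auto simp: hyperbolic_def\<close>)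
    then show "\<Omega> (P v) (b j) = 0" using that by simp
  qed
  let ?B = "a ` {..<k} \<union> b ` {..<k}"
  have "card ?B \<le> 2 * k"
    using card_Un_le[of "a ` {..<k}" "b ` {..<k}"] card_image_le[of "{..<k}" a] card_image_le[of "{..<k}" b]
    by simp
  moreover have "dim (UNIV :: 'v set) \<le> card ?B" if "span ?B = UNIV"
    using that by (intro dim_le_card) auto
  ultimately obtain v where v: "v \<notin> span ?B"
    using dim by fastforce
  have "P v \<noteq> 0"
  proof
    assume "P v = 0"
    then have "v = (\<Sum>i<k. scale (\<Omega> v (b i)) (a i) - scale (\<Omega> v (a i)) (b i))"
      by (simp add: P_def)
    also have "\<dots> \<in> span ?B"
      by (intro span_sum span_diff span_scale span_base) auto
    finally show False using v by simp
  qed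
  then obtain u where u: "\<Omega> (P v) u \<noteq> 0" using nondegenerate by blast
  define p where "p = P v"
  define q where "q = scale (1 / \<Omega> (P v) u) (P u)"
  have "\<Omega> (P v) (P u) = \<Omega> (P v) u"
    by (subst (2) P_def) (simp add: form_simps Pa Pb)
  then have "\<Omega> p q = 1" using u by (simp add: p_def q_def form_simps)
  moreover have "\<Omega> p (a j) = 0" "\<Omega> p (b j) = 0" "\<Omega> q (a j) = 0" "\<Omega> q (b j) = 0"
    "\<Omega> (a j) p = 0" "\<Omega> (b j) p = 0" "\<Omega> (a j) q = 0" "\<Omega> (b j) q = 0" if "j < k" for j
    using Pa[OF that] Pb[OF that] skew_symmetric[of "a j"] skew_symmetric[of "b j"]
    by (simp_all add: p_def q_def form_simps)
  ultimately have "hyperbolic (Suc k) (a(k := p)) (b(k := q))"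
    using ab by (auto simp: hyperbolic_def less_Suc_eq form_self)
  then show ?thesis by (rule that)
qed

lemma hyperbolic_exists:
  assumes "e \<noteq> 0" "2 * Suc k \<le> dim (UNIV :: 'v set)"
  shows "\<exists>a b. hyperbolic (Suc k) a b \<and> b 0 = e"
  using assms(2)
proof (induction k)
  case 0
  obtain u where u: "\<Omega> e u \<noteq> 0" using nondegenerate assms(1) by blast
  then have "\<Omega> (scale (1 / \<Omega> u e) u) e = 1"
    using skew_symmetric[of u e] by (simp add: form_scale form_minus)
  then have "hyperbolic (Suc 0) (\<lambda>_. scale (1 / \<Omega> u e) u) (\<lambda>_. e)"
    by (simp add: hyperbolic_def form_self)
  then show ?case by blast
next
  case (Suc k)
  then obtain a b where ab: "hyperbolic (Suc k) a b" "b 0 = e" by auto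
  moreover have "2 * Suc k < dim (UNIV :: 'v set)" using Suc.prems by simp
  ultimately obtain p q where "hyperbolic (Suc (Suc k)) (a(Suc k := p)) (b(Suc k := q))"
    by (blast elim: hyperbolic_extend)
  then show ?case
    using ab(2) by (intro exI conjI) (assumption, simp)
qed

text \<open>
  The Gram matrix of \<open>w 0, \<dots>, w M\<close> is invertible, so these vectors are independent and, by their
  number, a basis.  The coefficients of the expansion are read off by pairing with the dual basis
  \<open>(-1) ^ i w (M - i)\<close>.
\<close>

lemma darboux_expansion:
  assumes form_w: "\<And>i j. \<Omega> (w i) (w j) = (if i + j = M then (-1) ^ i else 0)"
    and dim: "dim (UNIV :: 'v set) = Suc M"
  shows "v = (\<Sum>i\<le>M. scale ((-1) ^ i * \<Omega> v (w (M - i))) (w i))"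
proof -
  obtain Basis :: "'v set" where "finite Basis" "independent Basis" "span Basis = UNIV"
    using finite_basis_if_dim_pos dim by auto
  then interpret finite_dimensional_vector_space scale Basis
    by unfold_locales
  have inj: "inj_on w {..M}"
  proof
    fix i j assume ij: "i \<in> {..M}" "j \<in> {..M}" "w i = w j"
    then have "\<Omega> (w j) (w (M - i)) \<noteq> 0"
      using form_w[of i "M - i"] by simp
    then show "i = j" using ij form_w[of j "M - i"] by (auto split: if_splits)
  qed
  have pair: "\<Omega> (\<Sum>i\<le>M. scale (f i) (w i)) (w j) = (if j \<le> M then f (M - j) * (-1) ^ (M - j) else 0)" for f j
  proof -
    have "\<Omega> (\<Sum>i\<le>M. scale (f i) (w i)) (w j) = (\<Sum>i\<le>M. if i = M - j then (if j \<le> M then f i * (-1) ^ i else 0) else 0)"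
      unfolding form_simps by (intro sum.cong refl) (auto simp: form_w)
    then show ?thesis by simp
  qed
  have "independent (w ` {..M})"
  proof (rule independent_if_scalars_zero)
    fix f x assume zero: "(\<Sum>x\<in>w ` {..M}. scale (f x) x) = 0" and "x \<in> w ` {..M}"
    then obtain i where i: "i \<le> M" "x = w i" by auto
    have "(\<Sum>i\<le>M. scale (f (w i)) (w i)) = 0"
      using zero inj by (simp add: sum.reindex)
    then show "f x = 0"
      using pair[of "\<lambda>i. f (w i)" "M - i"] i by (simp add: form_zero)
  qed simp
  moreover have "dim (UNIV :: 'v set) \<le> card (w ` {..M})"
    unfolding dim by (simp add: card_image inj)
  ultimately have span: "UNIV \<subseteq> span (w ` {..M})"
    by (intro card_ge_dim_independent) auto
  let ?r = "v - (\<Sum>i\<le>M. scale ((-1) ^ i * \<Omega> v (w (M - i))) (w i))"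
  have orth: "\<Omega> ?r (w j) = 0" if "j \<le> M" for j
    using that by (simp add: form_diff pair mult.assoc[symmetric] flip: power_mult_distrib)
  have "?r = 0"
  proof (rule nondegenerate)
    fix x
    have "x \<in> span (w ` {..M})" using span by blast
    then show "\<Omega> ?r x = 0"
    proof (induction rule: span_induct)
      case base
      then show ?case by (auto simp: subspace_def form_add(2) form_scale(2) form_zero(2))
    next
      case (step x)
      then show ?case using orth by blast
    qed
  qed
  then show ?thesis by simp
qed

end

text \<open>
  Extending \<open>w\<close> by zero beyond \<open>M\<close> makes the formulas for the form, the shift and the filtration
  valid for all indices, without side conditions.
\<close>

locale darboux_chain = symplectic_space scale \<Omega>
  for scale :: "'k::field_char_0 \<Rightarrow> 'v::ab_group_add \<Rightarrow> 'v" and \<Omega> +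
  fixes M :: nat and w :: "nat \<Rightarrow> 'v"
  assumes odd_M: "odd M"
    and form_w: "\<And>i j. \<Omega> (w i) (w j) = (if i + j = M then (-1) ^ i else 0)"
    and w_beyond: "\<And>i. i > M \<Longrightarrow> w i = 0"
    and expand: "\<And>v. v = (\<Sum>i\<le>M. scale ((-1) ^ i * \<Omega> v (w (M - i))) (w i))"

context symplectic_space_char_0
begin

text \<open>
  Up to signs, a chain lists the first halves of the hyperbolic pairs followed by the second halves in
  reverse order.  Hence the pair that contains \<open>e\<close> supplies both ends of the chain.
\<close>

lemma darboux_chain_exists:
  assumes "n \<ge> 1" "dim (UNIV :: 'v set) = 2 * n" "e \<noteq> 0"
  obtains w where "darboux_chain scale \<Omega> (2 * n - 1) w" "w (2 * n - 1) = e"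
proof -
  obtain k where k: "n = Suc k" using assms(1) by (cases n) auto
  then obtain a b where ab: "hyperbolic n a b" "b 0 = e"
    using hyperbolic_exists[of e k] assms by auto
  define M where "M = 2 * n - 1"
  have M: "Suc M = 2 * n" using assms(1) by (simp add: M_def)
  then have odd: "odd M" by (metis dvd_triv_left even_Suc)
  define w where "w i = (if i < n then a i else if i \<le> M then scale ((-1) ^ (M - i)) (b (M - i)) else 0)" for i
  have form_ab: "\<Omega> (a i) (a j) = 0" "\<Omega> (b i) (b j) = 0" "\<Omega> (a i) (b j) = (if i = j then 1 else 0)"
    "\<Omega> (b j) (a i) = (if i = j then -1 else 0)" if "i < n" "j < n" for i j
    using ab(1) that skew_symmetric[of "b j" "a i"] by (simp_all add: hyperbolic_def)
  have sign: "(-1) ^ (M - i) = - ((-1) ^ i :: 'k)" if "i \<le> M" for i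
    using that odd by (simp add: minus_one_power_iff)
  have form_w: "\<Omega> (w i) (w j) = (if i + j = M then (-1) ^ i else 0)" for i j
  proof -
    consider "i > M \<or> j > M" | "i < n" "j < n" | "i < n" "n \<le> j" "j \<le> M"
      | "n \<le> i" "i \<le> M" "j < n" | "n \<le> i" "i \<le> M" "n \<le> j" "j \<le> M"
      by linarith
    then show ?thesis
    proof cases
      case 1
      then show ?thesis using M by (auto simp: w_def form_zero)
    next
      case 2
      then show ?thesis using M by (simp add: w_def form_ab)
    next
      case 3
      then have "M - j < n" "i = M - j \<longleftrightarrow> i + j = M" using M by auto
      then show ?thesis using 3 by (auto simp: w_def form_ab form_scale)
    next
      case 4
      then have "M - i < n" "j = M - i \<longleftrightarrow> i + j = M" using M by auto
      then show ?thesis using 4 by (simp add: w_def form_ab form_scale form_minus sign)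
    next
      case 5
      then have "M - i < n" "M - j < n" "i + j \<noteq> M" using M by auto
      then show ?thesis using 5 by (simp add: w_def form_ab form_scale)
    qed
  qed
  have "darboux_chain scale \<Omega> M w"
  proof
    show "v = (\<Sum>i\<le>M. scale ((-1) ^ i * \<Omega> v (w (M - i))) (w i))" for v
      using assms(2) by (intro darboux_expansion form_w) (simp add: M)
  qed (use odd form_w M in \<open>auto simp: w_def\<close>)
  moreover have "w M = e" using M ab(2) assms(1) by (simp add: w_def)
  ultimately show ?thesis using that by (simp add: M_def)
qed

end

section \<open>The regular nilpotent element\<close>

context darboux_chain
begin

interpretation E: vector_space scale_endo by (rule vector_space_scale_endo)

definition shift :: "'v \<Rightarrow> 'v" where
  "shift v = (\<Sum>i\<le>M. scale ((-1) ^ i * \<Omega> v (w (M - i))) (w (Suc i)))"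

lemma shift_w: "shift (w j) = w (Suc j)"
proof (cases "j \<le> M")
  case True
  have "shift (w j) = (\<Sum>i\<le>M. if i = j then w (Suc i) else 0)"
    unfolding shift_def
    by (intro sum.cong refl) (use True in \<open>auto simp: form_w simp flip: power_add mult_2\<close>)
  then show ?thesis using True by simp
next
  case False
  then show ?thesis by (simp add: shift_def w_beyond form_simps)
qed

text \<open>
  Passing from \<open>i\<close> to \<open>M - 1 - i\<close> exchanges the terms of \<open>\<Omega> (shift u) v\<close> and \<open>\<Omega> u (shift v)\<close>.
  The parity of \<open>M\<close> preserves the sign of the coefficient, and skew-symmetry of the form reverses it.
\<close>

lemma shift_in_sp: "shift \<in> sp"
proof -
  have "\<Omega> (shift u) v = - \<Omega> u (shift v)" for u v
  proof -
    obtain K where K: "M = Suc K" "even K" using odd_M by (metis even_Suc odd_pos gr0_conv_Suc)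
    have "\<Omega> (shift u) v = (\<Sum>i\<le>K. (-1) ^ i * \<Omega> u (w (Suc K - i)) * \<Omega> (w (Suc i)) v)"
      unfolding shift_def form_simps by (simp add: K(1) w_beyond form_zero)
    also have "\<dots> = (\<Sum>i\<le>K. - ((-1) ^ i * \<Omega> v (w (Suc i)) * \<Omega> u (w (Suc K - i))))"
      by (intro sum.cong refl, subst (2) skew_symmetric) simp
    also have "\<dots> = (\<Sum>i\<le>K. - ((-1) ^ (K - i) * \<Omega> v (w (Suc (K - i))) * \<Omega> u (w (Suc K - (K - i)))))"
      by (rule sum.nat_diff_reindex[symmetric, of _ "Suc K", unfolded lessThan_Suc_atMost diff_Suc_Suc])
    also have "\<dots> = (\<Sum>i\<le>K. - ((-1) ^ i * \<Omega> v (w (Suc K - i)) * \<Omega> u (w (Suc i))))"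
      by (intro sum.cong refl) (use K in \<open>auto simp: Suc_diff_le minus_one_power_iff\<close>)
    also have "\<dots> = - \<Omega> u (shift v)"
      unfolding shift_def form_simps by (simp add: K(1) w_beyond form_zero sum_negf)
    finally show ?thesis .
  qed
  then show ?thesis
    by (auto simp: sp_iff shift_def form_simps algebra_simps sum.distrib scale_sum_right)
qed

lemma shift_nilpotent: "nilpotent_endo shift"
proof -
  have pow_w: "(shift ^^ k) (w j) = w (j + k)" for k j
    by (induction k) (simp_all add: shift_w)
  have lin: "(shift ^^ k) (x + y) = (shift ^^ k) x + (shift ^^ k) y"
    "(shift ^^ k) (scale c x) = scale c ((shift ^^ k) x)" for k x y c
    using shift_in_sp by (induction k) (auto simp: sp_iff)
  have sum: "(shift ^^ k) (\<Sum>i\<in>I. f i) = (\<Sum>i\<in>I. (shift ^^ k) (f i))" for k and I :: "nat set" and f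
    using lin(2)[of k 0 0]
    by (induction I rule: infinite_finite_induct) (simp_all add: lin)
  have "(shift ^^ Suc M) v = 0" for v
    by (subst expand[of v], unfold sum lin pow_w) (simp add: w_beyond)
  then show ?thesis unfolding nilpotent_endo_def by (metis ext zero_fun_def)
qed

section \<open>The weight filtration\<close>

definition filt :: "nat \<Rightarrow> ('v \<Rightarrow> 'v) set" where
  "filt d = E.span {sym_prod (w i) (w j) |i j. d \<le> i + j}"

lemma filt_base: "d \<le> i + j \<Longrightarrow> sym_prod (w i) (w j) \<in> filt d"
  unfolding filt_def by (rule E.span_base) blast

lemma filt_add: "A \<in> filt d \<Longrightarrow> B \<in> filt d \<Longrightarrow> A + B \<in> filt d"
  unfolding filt_def by (rule E.span_add)

lemma filt_diff: "A \<in> filt d \<Longrightarrow> B \<in> filt d \<Longrightarrow> A - B \<in> filt d"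
  unfolding filt_def by (rule E.span_diff)

lemma filt_scale: "A \<in> filt d \<Longrightarrow> scale_endo c A \<in> filt d"
  unfolding filt_def by (rule E.span_scale)

lemma filt_sum: "(\<And>i. i \<in> I \<Longrightarrow> f i \<in> filt d) \<Longrightarrow> sum f I \<in> filt d"
  unfolding filt_def by (rule E.span_sum)

lemma filt_mono: "d \<le> e \<Longrightarrow> filt e \<subseteq> filt d"
  unfolding filt_def by (rule E.span_mono) force

lemma filt_subset_sp: "filt d \<subseteq> sp"
  unfolding filt_def by (rule E.span_minimal) (auto intro: subspace_sp sym_prod_in_sp)

lemma commutator_filt_extend:
  assumes "A \<in> sp" and "\<And>i j. d \<le> i + j \<Longrightarrow> commutator A (sym_prod (w i) (w j)) \<in> filt e"
    and "B \<in> filt d"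
  shows "commutator A B \<in> filt e"
  using assms(3) unfolding filt_def[of d]
proof (induction rule: E.span_induct)
  case base
  then show ?case
    using assms(1) by (auto simp: E.subspace_def commutator_add_right commutator_scale_right
        commutator_zero_right filt_add filt_scale) (simp add: filt_def E.span_zero)
next
  case (step x)
  then show ?case using assms(2) by auto
qed

lemma commutator_shift_filt: "B \<in> filt d \<Longrightarrow> commutator shift B \<in> filt (Suc d)"
  by (erule commutator_filt_extend[OF shift_in_sp, rotated])
    (auto simp: commutator_sym_prod shift_in_sp shift_w intro!: filt_add filt_base)

text \<open>
  The bracket of two products contracts one factor of each.  A nonzero contraction uses up
  indices with sum \<open>M\<close>, and this is how far the total weight drops.
\<close>

lemma commutator_filt_filt:
  assumes "A \<in> filt a" "B \<in> filt b" "e + M \<le> a + b"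
  shows "commutator A B \<in> filt e"
proof -
  have gen: "commutator (sym_prod (w i) (w j)) (sym_prod (w k) (w l)) \<in> filt e"
    if "e + M \<le> i + j + (k + l)" for i j k l
  proof -
    have "scale_endo (\<Omega> (w p) (w q)) (sym_prod (w r) (w s)) \<in> filt e"
      if "e + M \<le> p + q + r + s" for p q r s
    proof (cases "p + q = M")
      case True
      then show ?thesis using that by (intro filt_scale filt_base) simp
    next
      case False
      then show ?thesis by (simp add: form_w filt_def E.span_zero)
    qed
    with that show ?thesis
      by (simp only: commutator_sym_prod sym_prod_in_sp sym_prod_def[of _ _ "w k"] sym_prod_def[of _ _ "w l"]
          sym_prod_add sym_prod_scale sym_prod_add_right sym_prod_scale_right)
        (intro filt_add; simp)
  qed
  have "commutator A (sym_prod (w k) (w l)) \<in> filt e" if "b \<le> k + l" for k l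
  proof -
    have "commutator (sym_prod (w k) (w l)) A \<in> filt e"
      using assms that by (intro commutator_filt_extend[OF sym_prod_in_sp _ assms(1)] gen) simp
    then show ?thesis by (subst commutator_swap) (simp add: filt_def E.span_neg)
  qed
  then show ?thesis using assms filt_subset_sp by (blast intro: commutator_filt_extend)
qed

text \<open>
  Expanding \<open>x\<close> in \<open>A x\<close> and expanding \<open>A x\<close> itself gives two expressions for \<open>A x\<close>.  Their sum is
  symmetric: it is the action of \<open>\<Sum>i\<le>M. - (-1) ^ i (w (M - i)) (A (w i))\<close>.
\<close>

lemma sp_expansion:
  assumes "A \<in> sp"
  shows "scale_endo 2 A =
    (\<Sum>i\<le>M. \<Sum>j\<le>M. scale_endo (- ((-1) ^ i * (-1) ^ j * \<Omega> (A (w i)) (w (M - j)))) (sym_prod (w (M - i)) (w j)))"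
proof -
  have Asum: "A (\<Sum>i\<in>I. f i) = (\<Sum>i\<in>I. A (f i))" for I :: "nat set" and f
  proof -
    have "A 0 = 0" using assms by (metis sp_iff scale_zero_left)
    with assms show ?thesis by (induction I rule: infinite_finite_induct) (auto simp: sp_iff)
  qed
  have sumapp: "(\<Sum>i\<in>I. f i) x = (\<Sum>i\<in>I. f i x)" for I :: "nat set" and f :: "nat \<Rightarrow> 'v \<Rightarrow> 'v" and x
    by (induction I rule: infinite_finite_induct) auto
  have Asc: "A (scale c x) = scale c (A x)" and Ask: "\<Omega> (A u) v = - \<Omega> u (A v)" for c x u v
    using assms by (auto simp: sp_iff)
  have "scale_endo 2 A = (\<Sum>i\<le>M. scale_endo (- ((-1) ^ i)) (sym_prod (w (M - i)) (A (w i))))"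
  proof
    fix x
    have 1: "A x = (\<Sum>i\<le>M. scale (- ((-1) ^ i) * \<Omega> (w (M - i)) x) (A (w i)))"
      by (subst expand[of x], subst (2) skew_symmetric) (simp add: Asum Asc)
    have "A x = (\<Sum>i\<le>M. scale ((-1) ^ i * \<Omega> (A x) (w (M - i))) (w i))"
      by (rule expand)
    also have "\<dots> = (\<Sum>i\<le>M. scale ((-1) ^ (M - i) * \<Omega> (A x) (w (M - (M - i)))) (w (M - i)))"
      by (rule sum.nat_diff_reindex[symmetric, of _ "Suc M", unfolded lessThan_Suc_atMost diff_Suc_Suc])
    also have "\<dots> = (\<Sum>i\<le>M. scale (- ((-1) ^ i) * \<Omega> (A (w i)) x) (w (M - i)))"
    proof (intro sum.cong refl)
      fix i assume "i \<in> {..M}"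
      moreover have "\<Omega> (A (w i)) x = \<Omega> (A x) (w i)"
        using Ask[of "w i" x] skew_symmetric[of "w i" "A x"] by simp
      ultimately show "scale ((-1) ^ (M - i) * \<Omega> (A x) (w (M - (M - i)))) (w (M - i))
        = scale (- ((-1) ^ i) * \<Omega> (A (w i)) x) (w (M - i))"
        using odd_M by (simp add: minus_one_power_iff)
    qed
    finally have "A x + A x = (\<Sum>i\<le>M. scale (- ((-1) ^ i) * \<Omega> (w (M - i)) x) (A (w i)))
       + (\<Sum>i\<le>M. scale (- ((-1) ^ i) * \<Omega> (A (w i)) x) (w (M - i)))"
      using 1 by simp
    moreover have "scale_endo 2 A x = A x + A x"
      unfolding scale_endo_def by (metis scale_left_distrib one_add_one scale_one)
    ultimately show "scale_endo 2 A x = (\<Sum>i\<le>M. scale_endo (- ((-1) ^ i)) (sym_prod (w (M - i)) (A (w i)))) x"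
      by (simp add: sumapp scale_endo_def sym_prod_def scale_right_distrib sum.distrib sum_negf sum_subtractf)
  qed
  also have "\<dots> = (\<Sum>i\<le>M. \<Sum>j\<le>M. scale_endo (- ((-1) ^ i * (-1) ^ j * \<Omega> (A (w i)) (w (M - j)))) (sym_prod (w (M - i)) (w j)))"
  proof (intro sum.cong refl)
    fix i
    show "scale_endo (- ((-1) ^ i)) (sym_prod (w (M - i)) (A (w i))) = 
      (\<Sum>j\<le>M. scale_endo (- ((-1) ^ i * (-1) ^ j * \<Omega> (A (w i)) (w (M - j)))) (sym_prod (w (M - i)) (w j)))"
      by (subst expand[of "A (w i)"])
        (simp add: sym_prod_sum_right sym_prod_scale_right E.scale_sum_right mult.assoc)
  qed
  finally show ?thesis .
qed

text \<open>
  In \<open>sp_expansion\<close> only the term with \<open>i = M\<close> and \<open>j = 0\<close> has weight \<open>0\<close>.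
\<close>

lemma leading_coefficient:
  assumes "A \<in> sp"
  shows "A - scale_endo (\<Omega> (A (w M)) (w M) / 2) (sym_prod (w 0) (w 0)) \<in> filt 1"
proof -
  define f where "f i j = scale_endo (- ((-1) ^ i * (-1) ^ j * \<Omega> (A (w i)) (w (M - j)))) (sym_prod (w (M - i)) (w j))" for i j
  have mem: "f i j \<in> filt 1" if "i < M \<or> 0 < j" for i j
    unfolding f_def using that by (intro filt_scale filt_base) auto
  have "scale_endo 2 A = (\<Sum>i<M. \<Sum>j\<le>M. f i j) + (\<Sum>j\<le>M. f M j)"
    unfolding sp_expansion[OF assms] f_def by (simp flip: lessThan_Suc_atMost)
  also have "(\<Sum>j\<le>M. f M j) = f M 0 + (\<Sum>j\<in>{..M}-{0}. f M j)"
    by (rule sum.remove) auto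
  finally have "scale_endo 2 A - f M 0 = (\<Sum>i<M. \<Sum>j\<le>M. f i j) + (\<Sum>j\<in>{..M}-{0}. f M j)"
    by (simp only: add.assoc[symmetric] add.commute[of "f M 0"] add_diff_cancel)
  moreover have "\<dots> \<in> filt 1"
    by (intro filt_add filt_sum mem) auto
  ultimately have "scale_endo (1/2) (scale_endo 2 A - f M 0) \<in> filt 1"
    by (simp add: filt_scale)
  moreover have "f M 0 = scale_endo (\<Omega> (A (w M)) (w M)) (sym_prod (w 0) (w 0))"
    using odd_M by (simp add: f_def)
  ultimately show ?thesis
    by (simp add: E.scale_right_diff_distrib)
qed

lemma sp_subset_filt_0: "sp \<subseteq> filt 0"
proof
  fix A assume "A \<in> sp"
  then have "scale_endo (1/2) (scale_endo 2 A) \<in> filt 0"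
    unfolding sp_expansion[OF \<open>A \<in> sp\<close>] by (intro filt_scale filt_sum filt_base) simp
  then show "A \<in> filt 0" by simp
qed

section \<open>Generation\<close>

text \<open>
  The element \<open>(ad shift)^d\<close> of \<open>(w 0) (w 0)\<close>, written out by the Leibniz rule.
\<close>

definition power_prod :: "nat \<Rightarrow> 'v \<Rightarrow> 'v" where
  "power_prod d = (\<Sum>i\<le>d. scale_endo (of_nat (d choose i)) (sym_prod (w i) (w (d - i))))"

lemma power_prod_in_filt: "power_prod d \<in> filt d"
  unfolding power_prod_def by (intro filt_sum filt_scale filt_base) simp

lemma commutator_shift_power_prod: "commutator shift (power_prod d) = power_prod (Suc d)"
proof -
  define g where "g i j = sym_prod (w i) (w j)" for i j
  have "commutator shift (power_prod d) =
    (\<Sum>i\<le>d. scale_endo (of_nat (d choose i)) (g (Suc i) (d - i)))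
      + (\<Sum>i\<le>d. scale_endo (of_nat (d choose i)) (g i (Suc d - i)))"
    by (simp add: power_prod_def g_def commutator_sum_right shift_in_sp commutator_scale_right
        commutator_sym_prod shift_w E.scale_right_distrib sum.distrib Suc_diff_le)
  also have "(\<Sum>i\<le>d. scale_endo (of_nat (d choose i)) (g i (Suc d - i)))
      = (\<Sum>i\<le>Suc d. scale_endo (of_nat (d choose i)) (g i (Suc d - i)))"
    by simp
  also have "\<dots> = g 0 (Suc d) + (\<Sum>i\<le>d. scale_endo (of_nat (d choose Suc i)) (g (Suc i) (d - i)))"
    by (subst sum.atMost_Suc_shift) simp
  also have "(\<Sum>i\<le>d. scale_endo (of_nat (d choose i)) (g (Suc i) (d - i)))
      + (g 0 (Suc d) + (\<Sum>i\<le>d. scale_endo (of_nat (d choose Suc i)) (g (Suc i) (d - i))))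
      = power_prod (Suc d)"
    unfolding power_prod_def g_def[symmetric]
    by (subst sum.atMost_Suc_shift) (simp add: E.scale_left_distrib sum.distrib)
  finally show ?thesis .
qed

text \<open>
  The bracket with \<open>(w 0) (w 0)\<close> is determined by the value of \<open>power_prod (m + M)\<close> at \<open>w 0\<close>.
  Only \<open>w M\<close> pairs nontrivially with \<open>w 0\<close>, which leaves the summands with \<open>i = M\<close> and with \<open>i = m\<close>.
\<close>

lemma commutator_square_power_prod:
  "commutator (sym_prod (w 0) (w 0)) (power_prod (m + M))
     = scale_endo (4 * of_nat ((m + M) choose M)) (sym_prod (w 0) (w m))"
proof -
  let ?d = "m + M"
  have app: "(\<Sum>i\<in>I. f i) x = (\<Sum>i\<in>I. f i x)" for I :: "nat set" and f :: "nat \<Rightarrow> 'v \<Rightarrow> 'v" and x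
    by (induction I rule: infinite_finite_induct) auto
  have f0: "\<Omega> (w i) (w 0) = (if i = M then -1 else 0)" for i
    using odd_M by (simp add: form_w)
  have "power_prod ?d (w 0) =
      (\<Sum>i\<le>?d. scale (of_nat (?d choose i)) (scale (\<Omega> (w i) (w 0)) (w (?d - i))))
    + (\<Sum>i\<le>?d. scale (of_nat (?d choose i)) (scale (\<Omega> (w (?d - i)) (w 0)) (w i)))"
    by (simp add: power_prod_def app scale_endo_def sym_prod_def scale_right_distrib sum.distrib)
  also have "(\<Sum>i\<le>?d. scale (of_nat (?d choose i)) (scale (\<Omega> (w i) (w 0)) (w (?d - i))))
     = (\<Sum>i\<le>?d. if i = M then - scale (of_nat (?d choose M)) (w m) else 0)"
    by (intro sum.cong refl) (simp add: f0)
  also have "(\<Sum>i\<le>?d. scale (of_nat (?d choose i)) (scale (\<Omega> (w (?d - i)) (w 0)) (w i)))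
     = (\<Sum>i\<le>?d. if i = m then - scale (of_nat (?d choose M)) (w m) else 0)"
    by (intro sum.cong refl) (auto simp: f0 binomial_symmetric[of m "m + M"])
  finally have "power_prod ?d (w 0) = - scale (of_nat (?d choose M)) (w m) - scale (of_nat (?d choose M)) (w m)"
    by simp
  also have "\<dots> = scale (- 2 * of_nat (?d choose M)) (w m)"
  proof -
    have "- 2 * k = - k - k" for k :: 'k by simp
    then show ?thesis by (simp only: scale_left_diff_distrib scale_minus_left)
  qed
  finally have pw: "power_prod ?d (w 0) = scale (- 2 * of_nat (?d choose M)) (w m)" .
  have "power_prod ?d \<in> sp"
    using power_prod_in_filt filt_subset_sp by blast
  then have "commutator (power_prod ?d) (sym_prod (w 0) (w 0))
     = scale_endo (- 2 * of_nat (?d choose M) + - 2 * of_nat (?d choose M)) (sym_prod (w 0) (w m))"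
    by (simp only: commutator_sym_prod pw sym_prod_scale sym_prod_scale_right sym_prod_commute[of "w m"]
        E.scale_left_distrib)
  then show ?thesis
    by (subst commutator_swap) (simp flip: E.scale_minus_left)
qed

text \<open>
  The hypothesis \<open>lead\<close> says that \<open>X\<close> equals a nonzero multiple of \<open>(w 0) (w 0)\<close> up to higher
  weight.  The facts \<open>powers\<close>, \<open>first\<close> and \<open>all\<close> in the proof realize more and more products as leading
  terms of elements of \<open>L\<close>; the higher terms are removed only at the end, from the top weight downwards.
\<close>

lemma sp_subset_lie_closed:
  assumes L: "lie_closed L" and X: "X \<in> L" "X \<in> sp" and Y: "shift \<in> L"
    and lead: "\<Omega> (X (w M)) (w M) \<noteq> 0"
  shows "sp \<subseteq> L"
proof -
  have subL: "E.subspace L" and comm: "A \<in> L \<Longrightarrow> B \<in> L \<Longrightarrow> commutator A B \<in> L" for A B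
    using L by (auto simp: lie_closed_def)
  define c where "c = \<Omega> (X (w M)) (w M) / 2"
  have "c \<noteq> 0" using lead by (simp add: c_def)
  let ?q = "sym_prod (w 0) (w 0)"
  have X1: "X - scale_endo c ?q \<in> filt 1"
    unfolding c_def by (rule leading_coefficient[OF X(2)])
  have powers: "\<exists>A\<in>L. A - scale_endo c (power_prod d) \<in> filt (Suc d)" for d
  proof (induction d)
    case 0
    have "power_prod 0 = ?q" by (rule ext) (simp add: power_prod_def)
    then show ?case using X(1) X1 by (metis One_nat_def)
  next
    case (Suc d)
    then obtain A where A: "A \<in> L" "A - scale_endo c (power_prod d) \<in> filt (Suc d)" by blast
    have "commutator shift A = commutator shift (A - scale_endo c (power_prod d))
       + commutator shift (scale_endo c (power_prod d))"
      by (simp flip: commutator_add_right[OF shift_in_sp])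
    then have "commutator shift A - scale_endo c (power_prod (Suc d))
       = commutator shift (A - scale_endo c (power_prod d))"
      by (simp add: commutator_scale_right[OF shift_in_sp] commutator_shift_power_prod)
    then show ?case
      using commutator_shift_filt[OF A(2)] comm[OF Y A(1)] by metis
  qed
  have first: "\<exists>A\<in>L. A - sym_prod (w 0) (w m) \<in> filt (Suc m)" for m
  proof -
    define T where "T = scale_endo c (power_prod (m + M))"
    have T: "T \<in> filt (m + M)" unfolding T_def by (intro filt_scale power_prod_in_filt)
    obtain A where A: "A \<in> L" "A - T \<in> filt (Suc (m + M))"
      using powers[of "m + M"] by (auto simp: T_def)
    define k where "k = c * c * (4 * of_nat ((m + M) choose M))"
    have "k \<noteq> 0" using \<open>c \<noteq> 0\<close> by (simp add: k_def)
    have Tsp: "T \<in> sp" using T filt_subset_sp by blast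
    have "commutator X A = commutator X (A - T) + commutator X T"
      by (simp flip: commutator_add_right[OF X(2)])
    moreover have "commutator X T = commutator (X - scale_endo c ?q) T + commutator (scale_endo c ?q) T"
      by (simp flip: commutator_add_left[OF Tsp])
    moreover have "commutator (scale_endo c ?q) T = scale_endo k (sym_prod (w 0) (w m))"
      unfolding commutator_scale_left[OF Tsp]
      by (simp add: T_def commutator_scale_right sym_prod_in_sp commutator_square_power_prod k_def mult.assoc)
    ultimately have "commutator X A - scale_endo k (sym_prod (w 0) (w m))
        = commutator X (A - T) + commutator (X - scale_endo c ?q) T"
      by simp
    moreover have "\<dots> \<in> filt (Suc m)"
      using X(2) sp_subset_filt_0
      by (intro filt_add commutator_filt_filt[OF _ A(2), where a = 0] commutator_filt_filt[OF X1 T]) auto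
    ultimately have "scale_endo (1 / k) (commutator X A - scale_endo k (sym_prod (w 0) (w m))) \<in> filt (Suc m)"
      by (simp add: filt_scale)
    then have "scale_endo (1 / k) (commutator X A) - sym_prod (w 0) (w m) \<in> filt (Suc m)"
      using \<open>k \<noteq> 0\<close> by (simp add: E.scale_right_diff_distrib)
    moreover have "scale_endo (1 / k) (commutator X A) \<in> L"
      by (intro E.subspace_scale[OF subL] comm X A)
    ultimately show ?thesis by blast
  qed
  have all: "\<exists>A\<in>L. A - sym_prod (w i) (w m) \<in> filt (Suc (i + m))" for i m
  proof (induction i arbitrary: m)
    case 0
    then show ?case using first[of m] by (metis add_0)
  next
    case (Suc i)
    obtain A where A: "A \<in> L" "A - sym_prod (w i) (w m) \<in> filt (Suc (i + m))"
      using Suc.IH by blast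
    obtain B where B: "B \<in> L" "B - sym_prod (w i) (w (Suc m)) \<in> filt (Suc (i + Suc m))"
      using Suc.IH by blast
    have "commutator shift A = commutator shift (A - sym_prod (w i) (w m)) + commutator shift (sym_prod (w i) (w m))"
      by (simp flip: commutator_add_right[OF shift_in_sp])
    then have "commutator shift A - B - sym_prod (w (Suc i)) (w m)
       = commutator shift (A - sym_prod (w i) (w m)) - (B - sym_prod (w i) (w (Suc m)))"
      by (simp add: commutator_sym_prod shift_in_sp shift_w)
    moreover have "\<dots> \<in> filt (Suc (Suc i + m))"
      using filt_diff[OF commutator_shift_filt[OF A(2)]] B(2) by simp
    moreover have "commutator shift A - B \<in> L"
      by (intro E.subspace_diff[OF subL] comm Y A B)
    ultimately show ?case by metis
  qed
  have "filt (2 * M + 1 - k) \<subseteq> L" for k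
  proof (induction k)
    case 0
    (* a product of weight above 2 * M has a factor w i with i > M, which is zero *)
    have "sym_prod (w i) (w j) \<in> L" if "Suc (2 * M) \<le> i + j" for i j
    proof -
      have "i > M \<or> j > M" using that by linarith
      then show ?thesis using E.subspace_0[OF subL] by (auto simp: w_beyond sym_prod_zero)
    qed
    then show ?case
      unfolding filt_def by (intro E.span_minimal subL) auto
  next
    case (Suc k)
    have "sym_prod (w i) (w j) \<in> L" if "2 * M + 1 - Suc k \<le> i + j" for i j
    proof -
      obtain A where A: "A \<in> L" "A - sym_prod (w i) (w j) \<in> filt (Suc (i + j))"
        using all by blast
      have "filt (Suc (i + j)) \<subseteq> L"
        using Suc.IH filt_mono[of "2 * M + 1 - k" "Suc (i + j)"] that by fastforce
      then have "A - (A - sym_prod (w i) (w j)) \<in> L"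
        using E.subspace_diff[OF subL A(1)] A(2) by blast
      then show ?thesis by simp
    qed
    then show ?case
      unfolding filt_def by (intro E.span_minimal subL) auto
  qed
  from this[of "2 * M + 1"] show ?thesis using sp_subset_filt_0 by simp
qed

end

theorem theorem1:
  fixes scale :: "'k::{alg_closed_field, field_char_0} \<Rightarrow> 'v::ab_group_add \<Rightarrow> 'v"
    and \<Omega> :: "'v \<Rightarrow> 'v \<Rightarrow> 'k"
    and n :: nat
    and X :: "'v \<Rightarrow> 'v"
  assumes "symplectic_space scale \<Omega>"
    and "n \<ge> 1"
    and "vector_space.dim scale (UNIV :: 'v set) = 2 * n"
    and "X \<in> symplectic_space.sp scale \<Omega>"
    and "nilpotent_endo X"
    and "X \<noteq> 0"
  shows "\<exists>Y \<in> symplectic_space.sp scale \<Omega>. nilpotent_endo Y \<and>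
    vector_space.lie_generates scale {X, Y} (symplectic_space.sp scale \<Omega>)"
proof -
  interpret symplectic_space scale \<Omega> by fact
  interpret symplectic_space_char_0 scale \<Omega> by unfold_locales
  obtain e where e: "\<Omega> (X e) e \<noteq> 0"
    using sp_quadratic_form_nonzero assms(4,6) by blast
  then have "e \<noteq> 0" by (auto simp: form_zero)
  then obtain w where chain: "darboux_chain scale \<Omega> (2 * n - 1) w" "w (2 * n - 1) = e"
    using darboux_chain_exists assms(2,3) by blast
  interpret darboux_chain scale \<Omega> "2 * n - 1" w by fact
  have "sp \<subseteq> L" if "lie_subalgebra L sp" "{X, shift} \<subseteq> L" for L
    using that e chain(2) assms(4) by (intro sp_subset_lie_closed) (auto simp: lie_subalgebra_def)
  then have "lie_generates {X, shift} sp"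
    unfolding lie_generates_def using assms(4) shift_in_sp
    by (intro hull_unique lie_subalgebra_sp) auto
  then show ?thesis using shift_in_sp shift_nilpotent by blast
qed

end
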